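(* Let $\Sigma$ be a fixed finite alphabet. There is an algorithm which, given a word $x\in\Sigma^*$ of length $n$, decides whether $x\in AQ(\Sigma)$ (i.e. whether $x$ is A-primitive) in worst-case time $O(n)$.
   Context: For an ordered alphabet $\Sigma=\{a_1,\dots,a_m\}$ and $w\in\Sigma^*$, the Parikh vector of $w$ is $\Psi(w)=(|w|_{a_1},\dots,|w|_{a_m})$, where $|w|_{a}$ is the number of occurrences of the letter $a$ in $w$. A word $w$ is a $k$-th Abelian power if $w=u_1u_2\cdots u_k$ for some words $u_1,\dots,u_k$ with $\Psi(u_i)=\Psi(u_j)$ for all $1\le i,j\le k$. A word $w$ is A-primitive if it is not a $k$-th Abelian power for any $k\ge 2$. $AQ(\Sigma)$ denotes the set of all A-primitive words in $\Sigma^*$. The alphabet size is a fixed constant (so the implied constant may depend on it). Running time is measured in the unit-cost random access model, where arithmetic operations on integers of size at most $n$ and memory accesses cost $O(1)$. *)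

theory Defs
  imports Complex_Main "HOL-Library.Landau_Symbols"
begin

text \<open>An ordered alphabet is a list of pairwise distinct letters; the words over \<open>A\<close> are
  the elements of \<open>lists (set A)\<close>.\<close>

definition parikh :: "'a list \<Rightarrow> 'a list \<Rightarrow> nat list" where
  "parikh A w = map (count_list w) A"

definition abelian_power :: "'a list \<Rightarrow> nat \<Rightarrow> 'a list \<Rightarrow> bool" where
  "abelian_power A k w \<longleftrightarrow>
    (\<exists>us. length us = k \<and> w = concat us \<and>
      (\<forall>i<k. \<forall>j<k. parikh A (us ! i) = parikh A (us ! j)))"

definition A_primitive :: "'a list \<Rightarrow> 'a list \<Rightarrow> bool" where
  "A_primitive A w \<longleftrightarrow> \<not> (\<exists>k\<ge>2. abelian_power A k w)"

definition AQ :: "'a list \<Rightarrow> 'a list set" where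
  "AQ A = {w \<in> lists (set A). A_primitive A w}"


text \<open>A machine has registers, addressed directly by instructions (so a program uses only
  finitely many), and a memory accessed indirectly through addresses held in registers.
  Subtraction is truncated at zero, and division is that of \<^typ>\<open>nat\<close>, so
  \<open>a div 0 = 0\<close> and \<open>a mod 0 = a\<close>.\<close>

datatype instr =
    Const nat nat       \<comment> \<open>\<open>R[r] := k\<close>\<close>
  | Move nat nat        \<comment> \<open>\<open>R[r] := R[a]\<close>\<close>
  | Add nat nat nat     \<comment> \<open>\<open>R[r] := R[a] + R[b]\<close>, and similarly below\<close>
  | Sub nat nat nat
  | Mul nat nat nat
  | Div nat nat nat
  | Mod nat nat nat
  | Load nat nat        \<comment> \<open>\<open>R[r] := M[R[a]]\<close>\<close>
  | Store nat nat       \<comment> \<open>\<open>M[R[a]] := R[b]\<close>\<close>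
  | Jump nat
  | JumpZero nat nat    \<comment> \<open>\<open>if R[a] = 0 then goto l\<close>\<close>
  | Halt bool           \<comment> \<open>stop and answer yes or no\<close>

record config =
  pc :: nat
  regs :: "nat \<Rightarrow> nat"
  mem :: "nat \<Rightarrow> nat"

definition set_reg :: "nat \<Rightarrow> nat \<Rightarrow> config \<Rightarrow> config" where
  "set_reg r v c = c\<lparr>pc := Suc (pc c), regs := (regs c)(r := v)\<rparr>"

fun exec :: "instr \<Rightarrow> config \<Rightarrow> config" where
  "exec (Const r k) c = set_reg r k c"
| "exec (Move r a) c = set_reg r (regs c a) c"
| "exec (Add r a b) c = set_reg r (regs c a + regs c b) c"
| "exec (Sub r a b) c = set_reg r (regs c a - regs c b) c"
| "exec (Mul r a b) c = set_reg r (regs c a * regs c b) c"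
| "exec (Div r a b) c = set_reg r (regs c a div regs c b) c"
| "exec (Mod r a b) c = set_reg r (regs c a mod regs c b) c"
| "exec (Load r a) c = set_reg r (mem c (regs c a)) c"
| "exec (Store a b) c = c\<lparr>pc := Suc (pc c), mem := (mem c)(regs c a := regs c b)\<rparr>"
| "exec (Jump l) c = c\<lparr>pc := l\<rparr>"
| "exec (JumpZero a l) c = c\<lparr>pc := (if regs c a = 0 then l else Suc (pc c))\<rparr>"
| "exec (Halt b) c = c"

text \<open>If the program counter leaves the program, the machine is stuck without an answer.\<close>

definition step :: "instr list \<Rightarrow> config \<Rightarrow> config" where
  "step P c = (if pc c < length P then exec (P ! pc c) c else c)"

definition run :: "instr list \<Rightarrow> nat \<Rightarrow> config \<Rightarrow> config" where
  "run P t c = (step P ^^ t) c"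

definition halted_with :: "instr list \<Rightarrow> bool \<Rightarrow> config \<Rightarrow> bool" where
  "halted_with P b c \<longleftrightarrow> pc c < length P \<and> P ! pc c = Halt b"

text \<open>The position of a letter in the alphabet, counted from 0.\<close>

definition letter_code :: "'a list \<Rightarrow> 'a \<Rightarrow> nat" where
  "letter_code A a = length (takeWhile (\<lambda>b. b \<noteq> a) A)"

text \<open>Initially, register 0 holds the length of the input word and the memory holds the codes
  of its letters, one per cell, starting at address 0.\<close>

definition init :: "'a list \<Rightarrow> 'a list \<Rightarrow> config" where
  "init A x =
    \<lparr>pc = 0,
     regs = (\<lambda>_. 0)(0 := length x),
     mem = (\<lambda>i. if i < length x then letter_code A (x ! i) else 0)\<rparr>"

definition values_bounded :: "nat \<Rightarrow> config \<Rightarrow> bool" where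
  "values_bounded b c \<longleftrightarrow> (\<forall>i. regs c i \<le> b \<and> mem c i \<le> b)"

text \<open>On each input of length \<open>n\<close>, the program \<open>P\<close> answers correctly after at most \<open>T n\<close> unit-cost
  steps, and no register or memory cell ever exceeds \<open>B n\<close>. The bound on values keeps the
  unit-cost measure honest; since addresses are register contents, it bounds the addresses
  accessed, too.\<close>

definition decides_within ::
    "instr list \<Rightarrow> 'a list \<Rightarrow> 'a list set \<Rightarrow> (nat \<Rightarrow> nat) \<Rightarrow> (nat \<Rightarrow> nat) \<Rightarrow> bool" where
  "decides_within P A L T B \<longleftrightarrow>
    (\<forall>x \<in> lists (set A). \<exists>t \<le> T (length x).
      halted_with P (x \<in> L) (run P t (init A x)) \<and>
      (\<forall>s\<le>t. values_bounded (B (length x)) (run P s (init A x))))"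

end

theory Submission imports Defs "HOL-Computational_Algebra.Primes" begin

text \<open>A word of length \<open>n\<close> is a \<open>k\<close>-th Abelian power iff \<open>k\<close> divides \<open>n\<close> and the prefix counts of
  every letter at the multiples of \<open>n div k\<close> grow linearly. With a table of prefix counts this is
  checked in \<open>O(k)\<close> steps. A \<open>k\<close>-th Abelian power is also a \<open>p\<close>-th Abelian power for every prime
  \<open>p\<close> dividing \<open>k\<close>, so only the prime divisors of \<open>n\<close> need to be tried; these are found by trial
  division. The tests cost \<open>O(n)\<close> altogether, because the test for \<open>p\<close> is followed by replacing the
  cofactor \<open>q\<close> by \<open>q div p\<close>, and \<open>p \<le> 2 * (q - q div p)\<close>: the cofactor pays for it. Testing
  all divisors instead would cost the sum of the divisors of \<open>n\<close>, which is not linear.\<close>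

section \<open>Structured code and time credits\<close>

text \<open>Jump targets are absolute, so code is a function of its start address.\<close>

type_synonym code = "nat \<Rightarrow> instr list"
type_synonym assertion = "(nat \<Rightarrow> nat) \<Rightarrow> (nat \<Rightarrow> nat) \<Rightarrow> nat \<Rightarrow> bool"

definition reach :: "instr list \<Rightarrow> nat \<Rightarrow> nat \<Rightarrow> config \<Rightarrow> config \<Rightarrow> bool" where
  "reach P B t c c' \<longleftrightarrow> run P t c = c' \<and> (\<forall>s\<le>t. values_bounded B (run P s c))"

lemma reach_refl: "values_bounded B c \<Longrightarrow> reach P B 0 c c"
  by (simp add: reach_def run_def)

lemma reach_step:
  "values_bounded B c \<Longrightarrow> step P c = c' \<Longrightarrow> values_bounded B c' \<Longrightarrow> reach P B 1 c c'"
  by (auto simp: reach_def run_def le_Suc_eq)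

lemma reach_bounded: "reach P B t c c' \<Longrightarrow> values_bounded B c'"
  by (auto simp: reach_def)

lemma reach_trans:
  assumes "reach P B t c c'" "reach P B u c' c''"
  shows "reach P B (t + u) c c''"
proof -
  have run_add: "run P (t + s) c = run P s c'" for s
    using assms(1) by (simp add: reach_def run_def add.commute[of t] funpow_add)
  have "values_bounded B (run P s c)" if "s \<le> t + u" for s
  proof (cases "s \<le> t")
    case False
    then obtain v where "s = t + v" by (metis le_iff_add nat_le_linear)
    with that run_add assms(2) show ?thesis by (simp add: reach_def)
  qed (use assms(1) in \<open>simp add: reach_def\<close>)
  with run_add[of u] assms(2) show ?thesis by (simp add: reach_def)
qed

abbreviation cfg :: "nat \<Rightarrow> (nat \<Rightarrow> nat) \<Rightarrow> (nat \<Rightarrow> nat) \<Rightarrow> config" where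
  "cfg l r M \<equiv> \<lparr>pc = l, regs = r, mem = M\<rparr>"

text \<open>The last argument of an assertion is the number of steps that may still be spent; every
  step costs one credit, so running out of credits is what rules out divergence.\<close>

definition wp :: "nat \<Rightarrow> code \<Rightarrow> assertion \<Rightarrow> assertion" where
  "wp B c Q r M k \<longleftrightarrow> (\<forall>pre post.
    values_bounded B (cfg (length pre) r M) \<longrightarrow>
    (\<exists>t\<le>k. \<exists>r' M'.
      reach (pre @ c (length pre) @ post) B t (cfg (length pre) r M)
        (cfg (length pre + length (c (length pre))) r' M') \<and>
      Q r' M' (k - t)))"

lemma wpI:
  assumes "\<And>pre post. values_bounded B (cfg (length pre) r M) \<Longrightarrow>
    \<exists>t\<le>k. \<exists>r' M'.
      reach (pre @ c (length pre) @ post) B t (cfg (length pre) r M)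
        (cfg (length pre + length (c (length pre))) r' M') \<and>
      Q r' M' (k - t)"
  shows "wp B c Q r M k"
  using assms unfolding wp_def by blast

lemma wpE:
  assumes "wp B c Q r M k" "P = pre @ c l @ post" "l = length pre"
    "values_bounded B (cfg l r M)"
  obtains t r' M' where "t \<le> k" "reach P B t (cfg l r M) (cfg (l + length (c l)) r' M')"
    "Q r' M' (k - t)"
  using assms unfolding wp_def by blast

text \<open>Only \<open>Const\<close>, \<open>Add\<close> and \<open>Mul\<close> carry a bound:
  every other result is at most a value already held by a register or cell. Control instructions
  give \<open>False\<close>, since a block is straight-line code.\<close>

fun wp_instr :: "nat \<Rightarrow> instr \<Rightarrow> assertion \<Rightarrow> assertion" where
  "wp_instr B (Const x v) Q r M k \<longleftrightarrow> 0 < k \<and> v \<le> B \<and> Q (r(x := v)) M (k - 1)"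
| "wp_instr B (Move x a) Q r M k \<longleftrightarrow> 0 < k \<and> Q (r(x := r a)) M (k - 1)"
| "wp_instr B (Add x a b) Q r M k \<longleftrightarrow>
    0 < k \<and> r a + r b \<le> B \<and> Q (r(x := r a + r b)) M (k - 1)"
| "wp_instr B (Sub x a b) Q r M k \<longleftrightarrow> 0 < k \<and> Q (r(x := r a - r b)) M (k - 1)"
| "wp_instr B (Mul x a b) Q r M k \<longleftrightarrow>
    0 < k \<and> r a * r b \<le> B \<and> Q (r(x := r a * r b)) M (k - 1)"
| "wp_instr B (Div x a b) Q r M k \<longleftrightarrow> 0 < k \<and> Q (r(x := r a div r b)) M (k - 1)"
| "wp_instr B (Mod x a b) Q r M k \<longleftrightarrow> 0 < k \<and> Q (r(x := r a mod r b)) M (k - 1)"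
| "wp_instr B (Load x a) Q r M k \<longleftrightarrow> 0 < k \<and> Q (r(x := M (r a))) M (k - 1)"
| "wp_instr B (Store a b) Q r M k \<longleftrightarrow> 0 < k \<and> Q r (M(r a := r b)) (k - 1)"
| "wp_instr B _ Q r M k \<longleftrightarrow> False"

primrec wp_block :: "nat \<Rightarrow> instr list \<Rightarrow> assertion \<Rightarrow> assertion" where
  "wp_block B [] Q = Q"
| "wp_block B (i # is) Q = wp_instr B i (wp_block B is Q)"

definition block :: "instr list \<Rightarrow> code" where
  "block is = (\<lambda>l. is)"

definition seq :: "code \<Rightarrow> code \<Rightarrow> code" (infixr ";;" 60) where
  "c ;; d = (\<lambda>l. c l @ d (l + length (c l)))"

text \<open>The 2 in the offsets counts the test and the jump over \<open>d\<close>;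
  \<open>d\<close> is the branch for zero.\<close>

definition cond :: "nat \<Rightarrow> code \<Rightarrow> code \<Rightarrow> code" where
  "cond a c d = (\<lambda>l.
    let p = c (l + 1); q = d (l + length p + 2)
    in JumpZero a (l + length p + 2) # p @ Jump (l + length p + length q + 2) # q)"

definition loop :: "code \<Rightarrow> nat \<Rightarrow> code \<Rightarrow> code" where
  "loop c a d = (\<lambda>l.
    let p = c l; q = d (l + length p + 1)
    in p @ JumpZero a (l + length p + length q + 2) # q @ [Jump l])"

section \<open>Soundness of the verification conditions\<close>

lemma wp_instr_step:
  assumes "wp_instr B i Q r M k" "values_bounded B (cfg l r M)"
  shows "\<exists>r' M'. 0 < k \<and> exec i (cfg l r M) = cfg (Suc l) r' M' \<and>
    values_bounded B (cfg (Suc l) r' M') \<and> Q r' M' (k - 1)"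
  using assms
  by (cases i) (auto simp: set_reg_def values_bounded_def
      intro: le_trans[OF diff_le_self] le_trans[OF div_le_dividend] le_trans[OF mod_less_eq_dividend])

lemma wp_block:
  assumes "wp_block B is Q r M k"
  shows "wp B (block is) Q r M k"
  using assms
proof (induction "is" arbitrary: r M k)
  case Nil
  then show ?case
    by (intro wpI exI[of _ "0::nat"] exI[of _ r] exI[of _ M] conjI)
      (auto simp: block_def reach_refl)
next
  case (Cons i "is")
  show ?case
  proof (rule wpI)
    fix pre post
    let ?P = "pre @ block (i # is) (length pre) @ post" and ?l = "length pre"
    assume bnd: "values_bounded B (cfg ?l r M)"
    from wp_instr_step[OF _ this] Cons.prems obtain r' M' where *:
      "0 < k" "exec i (cfg ?l r M) = cfg (Suc ?l) r' M'"
      "values_bounded B (cfg (Suc ?l) r' M')" "wp_block B is Q r' M' (k - 1)"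
      by fastforce
    have first: "reach ?P B 1 (cfg ?l r M) (cfg (Suc ?l) r' M')"
      using * bnd by (intro reach_step) (simp_all add: step_def block_def nth_append)
    obtain t r'' M'' where t: "t \<le> k - 1"
      "reach ?P B t (cfg (Suc ?l) r' M') (cfg (Suc ?l + length is) r'' M'')" "Q r'' M'' (k - 1 - t)"
      by (rule wpE[OF Cons.IH[OF *(4)], of ?P "pre @ [i]" "Suc ?l" post])
        (use *(3) in \<open>simp_all add: block_def that\<close>)
    show "\<exists>t\<le>k. \<exists>r' M'. reach ?P B t (cfg ?l r M)
        (cfg (?l + length (block (i # is) ?l)) r' M') \<and> Q r' M' (k - t)"
      using reach_trans[OF first t(2)] t(1,3) *(1)
      by (intro exI[of _ "1 + t"]) (auto simp: block_def)
  qed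
qed

lemma wp_seq:
  assumes "wp B c (wp B d Q) r M k"
  shows "wp B (c ;; d) Q r M k"
proof (rule wpI)
  fix pre post
  let ?P = "pre @ (c ;; d) (length pre) @ post" and ?l = "length pre"
  let ?l' = "?l + length (c ?l)"
  assume bnd: "values_bounded B (cfg ?l r M)"
  obtain t r' M' where t: "t \<le> k" "reach ?P B t (cfg ?l r M) (cfg ?l' r' M')"
    "wp B d Q r' M' (k - t)"
    by (rule wpE[OF assms, of ?P pre ?l "d ?l' @ post"])
      (use bnd in \<open>simp_all add: seq_def that\<close>)
  obtain u r'' M'' where u: "u \<le> k - t"
    "reach ?P B u (cfg ?l' r' M') (cfg (?l' + length (d ?l')) r'' M'')" "Q r'' M'' (k - t - u)"
    by (rule wpE[OF t(3), of ?P "pre @ c ?l" ?l' post])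
      (use reach_bounded[OF t(2)] in \<open>simp_all add: seq_def that\<close>)
  show "\<exists>t\<le>k. \<exists>r' M'. reach ?P B t (cfg ?l r M)
      (cfg (?l + length ((c ;; d) ?l)) r' M') \<and> Q r' M' (k - t)"
    using reach_trans[OF t(2) u(2)] t(1) u(1,3)
    by (intro exI[of _ "t + u"]) (auto simp: seq_def add.assoc)
qed

text \<open>Only the nonzero branch has to keep one credit back, for the jump over \<open>d\<close>;
  the zero branch ends where the whole statement ends.\<close>

lemma wp_cond:
  assumes "0 < k"
    and "r a \<noteq> 0 \<Longrightarrow> wp B c (\<lambda>r M k. 0 < k \<and> Q r M (k - 1)) r M (k - 1)"
    and "r a = 0 \<Longrightarrow> wp B d Q r M (k - 1)"
  shows "wp B (cond a c d) Q r M k"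
proof (rule wpI)
  fix pre post
  let ?P = "pre @ cond a c d (length pre) @ post" and ?l = "length pre"
  define p where "p = c (?l + 1)"
  let ?m = "?l + length p + 2"
  define q where "q = d ?m"
  let ?e = "?m + length q"
  assume bnd: "values_bounded B (cfg ?l r M)"
  have P: "?P = pre @ JumpZero a ?m # p @ Jump ?e # q @ post"
    by (simp add: cond_def p_def q_def Let_def add_ac)
  have e: "?l + length (cond a c d ?l) = ?e"
    by (simp add: cond_def p_def q_def Let_def add_ac)
  have first: "reach ?P B 1 (cfg ?l r M) (cfg (if r a = 0 then ?m else ?l + 1) r M)"
    using bnd unfolding P
    by (intro reach_step) (auto simp: step_def nth_append values_bounded_def)
  show "\<exists>t\<le>k. \<exists>r' M'. reach ?P B t (cfg ?l r M)
      (cfg (?l + length (cond a c d ?l)) r' M') \<and> Q r' M' (k - t)"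
  proof (cases "r a = 0")
    case True
    obtain t r' M' where t: "t \<le> k - 1" "reach ?P B t (cfg ?m r M) (cfg ?e r' M')"
      "Q r' M' (k - 1 - t)"
      by (rule wpE[OF assms(3)[OF True], of ?P "pre @ JumpZero a ?m # p @ [Jump ?e]" ?m post])
        (use P reach_bounded[OF first] True in \<open>simp_all add: q_def that\<close>)
    show ?thesis
      using reach_trans[OF first, of t "cfg ?e r' M'"] t assms(1) True
      unfolding e by (intro exI[of _ "1 + t"]) auto
  next
    case False
    obtain t r' M' where t: "t \<le> k - 1"
      "reach ?P B t (cfg (?l + 1) r M) (cfg (?l + 1 + length p) r' M')"
      "0 < k - 1 - t" "Q r' M' (k - 1 - t - 1)"
      by (rule wpE[OF assms(2)[OF False], of ?P "pre @ [JumpZero a ?m]" "?l + 1" "Jump ?e # q @ post"])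
        (use P reach_bounded[OF first] False in \<open>simp_all add: p_def that\<close>)
    have "reach ?P B 1 (cfg (?l + 1 + length p) r' M') (cfg ?e r' M')"
      using reach_bounded[OF t(2)] unfolding P
      by (intro reach_step) (auto simp: step_def nth_append values_bounded_def)
    from reach_trans[OF reach_trans[OF _ t(2)] this, of 1 "cfg ?l r M"] first False
    show ?thesis
      using t assms(1) unfolding e by (intro exI[of _ "1 + t + 1"]) auto
  qed
qed

text \<open>The invariant speaks about the remaining credits, and each round spends at least two of
  them on the test and the jump back. Hence strong induction on \<open>k\<close> proves termination,
  and no separate variant is required.\<close>

lemma wp_loop:
  assumes init: "I r M k"
    and inv: "\<And>r M k. I r M k \<Longrightarrow>
      wp B c (\<lambda>r M k. 0 < k \<and>
        (if r a = 0 then Q r M (k - 1)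
         else wp B d (\<lambda>r M k. 0 < k \<and> I r M (k - 1)) r M (k - 1))) r M k"
  shows "wp B (loop c a d) Q r M k"
proof (rule wpI)
  fix pre post
  let ?P = "pre @ loop c a d (length pre) @ post" and ?l = "length pre"
  define p where "p = c ?l"
  let ?m = "?l + length p"
  define q where "q = d (?m + 1)"
  let ?e = "?m + length q + 2"
  have P: "?P = pre @ p @ JumpZero a ?e # q @ Jump ?l # post"
    by (simp add: loop_def p_def q_def Let_def add_ac)
  have e: "?l + length (loop c a d ?l) = ?e"
    by (simp add: loop_def p_def q_def Let_def add_ac)
  assume "values_bounded B (cfg ?l r M)"
  with init have "\<exists>t\<le>k. \<exists>r' M'. reach ?P B t (cfg ?l r M) (cfg ?e r' M') \<and> Q r' M' (k - t)"
  proof (induction k arbitrary: r M rule: less_induct)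
    case (less k)
    obtain t r1 M1 where t: "t \<le> k" "reach ?P B t (cfg ?l r M) (cfg ?m r1 M1)"
      "0 < k - t \<and> (if r1 a = 0 then Q r1 M1 (k - t - 1)
         else wp B d (\<lambda>r M k. 0 < k \<and> I r M (k - 1)) r1 M1 (k - t - 1))"
      by (rule wpE[OF inv[OF less.prems(1)], of ?P pre ?l "JumpZero a ?e # q @ Jump ?l # post"])
        (use P less.prems(2) in \<open>simp_all add: p_def that\<close>)
    have "reach ?P B 1 (cfg ?m r1 M1) (cfg (if r1 a = 0 then ?e else ?m + 1) r1 M1)"
      using reach_bounded[OF t(2)] unfolding P
      by (intro reach_step) (auto simp: step_def nth_append values_bounded_def)
    from reach_trans[OF t(2) this]
    have test: "reach ?P B (t + 1) (cfg ?l r M) (cfg (if r1 a = 0 then ?e else ?m + 1) r1 M1)" .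
    show ?case
    proof (cases "r1 a = 0")
      case True
      then show ?thesis using test t by (intro exI[of _ "t + 1"]) auto
    next
      case False
      with t(3) have body: "wp B d (\<lambda>r M k. 0 < k \<and> I r M (k - 1)) r1 M1 (k - t - 1)" by simp
      obtain u r2 M2 where u: "u \<le> k - t - 1"
        "reach ?P B u (cfg (?m + 1) r1 M1) (cfg (?m + 1 + length q) r2 M2)"
        "0 < k - t - 1 - u" "I r2 M2 (k - t - 1 - u - 1)"
        by (rule wpE[OF body, of ?P "pre @ p @ [JumpZero a ?e]" "?m + 1" "Jump ?l # post"])
          (use P reach_bounded[OF test] False in \<open>simp_all add: q_def that\<close>)
      have "reach ?P B 1 (cfg (?m + 1 + length q) r2 M2) (cfg ?l r2 M2)"
        using reach_bounded[OF u(2)] unfolding P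
        by (intro reach_step) (auto simp: step_def nth_append values_bounded_def)
      from reach_trans[OF reach_trans[OF _ u(2)] this, of "t + 1" "cfg ?l r M"] test False
      have round: "reach ?P B (t + 1 + u + 1) (cfg ?l r M) (cfg ?l r2 M2)" by simp
      obtain v r3 M3 where v: "v \<le> k - t - 1 - u - 1"
        "reach ?P B v (cfg ?l r2 M2) (cfg ?e r3 M3)" "Q r3 M3 (k - t - 1 - u - 1 - v)"
        using less.IH[OF _ u(4) reach_bounded[OF round]] u(3) by auto
      show ?thesis
        using reach_trans[OF round v(2)] v(1,3) u(1,3) t(1,3)
        by (intro exI[of _ "t + 1 + u + 1 + v"]) auto
    qed
  qed
  then show "\<exists>t\<le>k. \<exists>r' M'. reach ?P B t (cfg ?l r M)
      (cfg (?l + length (loop c a d ?l)) r' M') \<and> Q r' M' (k - t)"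
    unfolding e .
qed

section \<open>Abelian powers in terms of prefix counts\<close>

lemma letter_code_less: "b \<in> set A \<Longrightarrow> letter_code A b < length A"
  unfolding letter_code_def by (induction A) auto

lemma nth_letter_code: "b \<in> set A \<Longrightarrow> A ! letter_code A b = b"
  using nth_length_takeWhile[of "\<lambda>c. c \<noteq> b" A] letter_code_less[of b A]
  by (auto simp: letter_code_def)

lemma letter_code_eq_iff:
  assumes "distinct A" "b \<in> set A" "a < length A"
  shows "letter_code A b = a \<longleftrightarrow> b = A ! a"
  using assms by (metis letter_code_less nth_letter_code nth_eq_iff_index_eq)

lemma count_list_letter_codes:
  assumes "distinct A" "x \<in> lists (set A)" "a < length A"
  shows "count_list (map (letter_code A) x) a = count_list x (A ! a)"
  using assms(2) by (induction x) (auto simp: letter_code_eq_iff[OF assms(1) _ assms(3)])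

lemma count_list_concat_const:
  assumes "\<And>u. u \<in> set us \<Longrightarrow> count_list u b = c"
  shows "count_list (concat us) b = length us * c"
  using assms by (induction us) auto

lemma length_concat_const:
  assumes "\<And>u. u \<in> set us \<Longrightarrow> length u = d"
  shows "length (concat us) = length us * d"
  using assms by (induction us) auto

text \<open>Hence the blocks of an Abelian power have equal length. Distinctness of \<open>A\<close>
  ensures that each letter contributes only once.\<close>

lemma length_eq_sum_parikh:
  assumes "distinct A" "w \<in> lists (set A)"
  shows "length w = sum_list (parikh A w)"
proof -
  have "sum_list (parikh A w) = (\<Sum>b\<in>set A. count_list w b)"
    using assms(1) by (simp add: parikh_def sum_list_distinct_conv_sum_set)
  also have "\<dots> = (\<Sum>b\<in>set w. count_list w b)"
    using assms(2) by (intro sum.mono_neutral_right) (auto simp: count_list_0_iff)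
  finally show ?thesis by (simp add: sum_count_set)
qed

lemma concat_blocks: "concat (map (\<lambda>j. take d (drop (j * d) x)) [0..<k]) = take (k * d) x"
  by (induction k) (simp_all add: take_add add.commute[of d])

definition prefix_count :: "nat list \<Rightarrow> nat \<Rightarrow> nat \<Rightarrow> nat" where
  "prefix_count y i a = count_list (take i y) a"

lemma prefix_count_0 [simp]: "prefix_count y 0 a = 0"
  by (simp add: prefix_count_def)

lemma prefix_count_Suc:
  "i < length y \<Longrightarrow> prefix_count y (Suc i) a = prefix_count y i a + (if y ! i = a then 1 else 0)"
  by (simp add: prefix_count_def take_Suc_conv_app_nth)

lemma prefix_count_le: "prefix_count y i a \<le> length y"
  unfolding prefix_count_def
  using count_le_length[of "take i y" a] by simp

text \<open>To be read together with \<open>k dvd length y\<close>, which makes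
  \<open>length y div k\<close> the length of a block.\<close>

definition equal_parts :: "nat \<Rightarrow> nat list \<Rightarrow> nat \<Rightarrow> bool" where
  "equal_parts m y k \<longleftrightarrow> (\<forall>j\<le>k. \<forall>a<m.
    prefix_count y (j * (length y div k)) a = j * prefix_count y (length y div k) a)"

text \<open>Merging groups of \<open>k div e\<close> consecutive blocks yields \<open>e\<close>
  blocks with equal counts. For prime \<open>e\<close> this is the reduction to prime
  exponents.\<close>

lemma equal_parts_mono:
  assumes "equal_parts m y k" "k dvd length y" "e dvd k" "0 < k"
  shows "equal_parts m y e"
proof -
  from assms(3) obtain f where k: "k = e * f" by (auto elim: dvdE)
  from assms(2) obtain d where len: "length y = k * d" by (auto elim: dvdE)
  have d: "length y div k = d" and fd: "length y div e = f * d" and ef: "0 < e" "0 < f"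
    using assms(4) k by (auto simp: len)
  have P: "prefix_count y (j * d) a = j * prefix_count y d a" if "j \<le> k" "a < m" for j a
    using assms(1) that by (simp add: equal_parts_def d)
  have "prefix_count y (j * (f * d)) a = j * prefix_count y (f * d) a" if "j \<le> e" "a < m" for j a
  proof -
    have "j * f \<le> k" using that by (simp add: k)
    moreover have "f \<le> k" using ef by (simp add: k)
    ultimately show ?thesis using P[of "j * f" a] P[of f a] that by (simp add: mult.assoc)
  qed
  then show ?thesis by (simp add: equal_parts_def fd)
qed

text \<open>Linear growth from 0 amounts to equal increments, and each increment is checked with
  three lookups. Block \<open>u div m\<close> and letter \<open>u mod m\<close> are packed into one
  index, matching the flattened loop of the program.\<close>

lemma equal_parts_iff_step:
  assumes "d = length y div k"
  shows "equal_parts m y k \<longleftrightarrow> (\<forall>u<k * m. prefix_count y (Suc (u div m) * d) (u mod m) =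
    prefix_count y (u div m * d) (u mod m) + prefix_count y d (u mod m))" (is "_ \<longleftrightarrow> ?R")
proof
  assume eq: "equal_parts m y k"
  show ?R
  proof (intro allI impI)
    fix u assume u: "u < k * m"
    then have "0 < m" by (cases m) auto
    then have "u div m < k" "u mod m < m" using u by (auto simp: less_mult_imp_div_less)
    then have "prefix_count y (j * d) (u mod m) = j * prefix_count y d (u mod m)"
      if "j \<in> {u div m, Suc (u div m)}" for j
      using eq that unfolding equal_parts_def assms by (metis insertE less_imp_le_nat Suc_leI singletonD)
    from this[of "u div m"] this[of "Suc (u div m)"]
    show "prefix_count y (Suc (u div m) * d) (u mod m) =
      prefix_count y (u div m * d) (u mod m) + prefix_count y d (u mod m)" by simp
  qed
next
  assume R: ?R
  have "prefix_count y (j * d) a = j * prefix_count y d a" if "j \<le> k" "a < m" for j a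
    using that
  proof (induction j)
    case (Suc j)
    \<comment> \<open>The index \<open>a + j * m\<close> encodes block \<open>j\<close> and letter
      \<open>a\<close>.\<close>
    have "a + j * m < Suc j * m" using Suc.prems by simp
    also have "\<dots> \<le> k * m" using Suc.prems by (intro mult_le_mono) auto
    finally have "a + j * m < k * m" .
    with R have "prefix_count y (Suc ((a + j * m) div m) * d) ((a + j * m) mod m) =
      prefix_count y ((a + j * m) div m * d) ((a + j * m) mod m) + prefix_count y d ((a + j * m) mod m)"
      by blast
    then show ?case using Suc by simp
  qed simp
  then show "equal_parts m y k" by (simp add: equal_parts_def assms)
qed

text \<open>Equal Parikh vectors force equal block lengths, so the boundaries lie at the multiples
  of one length, and the first \<open>j\<close> blocks contain \<open>j\<close> times the letters of
  a reference block \<open>v\<close>.\<close>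

lemma abelian_power_imp_equal_parts:
  assumes "distinct A" "x \<in> lists (set A)" "0 < k" "abelian_power A k x"
  shows "k dvd length x \<and> equal_parts (length A) (map (letter_code A) x) k"
proof -
  from assms(4) obtain us where us: "length us = k" "x = concat us"
    "\<And>i j. i < k \<Longrightarrow> j < k \<Longrightarrow> parikh A (us ! i) = parikh A (us ! j)"
    unfolding abelian_power_def by blast
  define v where "v = us ! 0"
  have pv: "parikh A u = parikh A v" if "u \<in> set us" for u
    using that us(1,3) assms(3) unfolding v_def by (metis in_set_conv_nth)
  have v: "v \<in> set us" using us(1) assms(3) by (simp add: v_def)
  have lists: "u \<in> lists (set A)" if "u \<in> set us" for u
    using assms(2) that by (auto simp: us(2))
  have len: "length u = length v" if "u \<in> set us" for u
    using length_eq_sum_parikh[OF assms(1) lists] that v pv by metis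
  have cnt: "count_list u (A ! a) = count_list v (A ! a)" if "u \<in> set us" "a < length A" for u a
    using pv[OF that(1)] that(2) by (auto simp: parikh_def)
  have n: "length x = k * length v"
    using length_concat_const[OF len] by (simp add: us)
  have pre: "take (j * length v) x = concat (take j us)" if "j \<le> k" for j
  proof -
    have "x = concat (take j us) @ concat (drop j us)"
      by (simp add: us(2) flip: concat_append)
    moreover have "length (concat (take j us)) = j * length v"
      using length_concat_const[of "take j us" "length v"] len that us(1)
      by (auto dest: in_set_takeD)
    ultimately show ?thesis by (metis append_eq_conv_conj)
  qed
  have pc: "prefix_count (map (letter_code A) x) (j * length v) a = j * count_list v (A ! a)"
    if "j \<le> k" "a < length A" for j a
  proof -
    have "take (j * length v) x \<in> lists (set A)"
      using assms(2) by (auto dest: in_set_takeD)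
    then have "prefix_count (map (letter_code A) x) (j * length v) a
        = count_list (concat (take j us)) (A ! a)"
      unfolding prefix_count_def take_map
      by (simp add: count_list_letter_codes[OF assms(1) _ that(2)] pre[OF that(1)])
    also have "\<dots> = j * count_list v (A ! a)"
      using count_list_concat_const[of "take j us" "A ! a" "count_list v (A ! a)"] cnt that us(1)
      by (auto dest: in_set_takeD)
    finally show ?thesis .
  qed
  \<comment> \<open>The case \<open>j = 1\<close> turns the counts in \<open>v\<close> into prefix
    counts.\<close>
  show ?thesis
    using pc pc[of 1] assms(3) by (auto simp: equal_parts_def n)
qed

lemma equal_parts_imp_abelian_power:
  assumes "distinct A" "x \<in> lists (set A)" "k dvd length x"
    and eq: "equal_parts (length A) (map (letter_code A) x) k"
  shows "abelian_power A k x"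
proof -
  define d where "d = length x div k"
  define u where "u j = take d (drop (j * d) x)" for j
  have "concat (map u [0..<k]) = x"
    using concat_blocks[of d x k] assms(3) by (simp add: u_def [abs_def] d_def)
  moreover have "parikh A (u j) = parikh A (take d x)" if "j < k" for j
  proof -
    have "count_list (u j) (A ! a) = count_list (take d x) (A ! a)" if "a < length A" for a
    proof -
      have pc: "prefix_count (map (letter_code A) x) i a = count_list (take i x) (A ! a)" for i
        unfolding prefix_count_def take_map
        using assms(2) by (intro count_list_letter_codes[OF assms(1) _ that]) (auto dest: in_set_takeD)
      have "count_list (take (i * d) x) (A ! a) = i * count_list (take d x) (A ! a)"
        if "i \<le> k" for i
      proof -
        have "length (map (letter_code A) x) div k = d" by (simp add: d_def)
        with eq that \<open>a < length A\<close> have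
          "prefix_count (map (letter_code A) x) (i * d) a = i * prefix_count (map (letter_code A) x) d a"
          unfolding equal_parts_def by metis
        then show ?thesis unfolding pc .
      qed
      \<comment> \<open>Subtracting the counts at two adjacent boundaries isolates block
        \<open>j\<close>.\<close>
      from this[of j] this[of "Suc j"] \<open>j < k\<close> show ?thesis
        by (simp add: u_def add.commute[of d] take_add)
    qed
    then show ?thesis
      unfolding parikh_def by (auto simp: in_set_conv_nth)
  qed
  ultimately show ?thesis
    unfolding abelian_power_def by (intro exI[of _ "map u [0..<k]"]) simp
qed

lemma A_primitive_iff:
  assumes "distinct A" "x \<in> lists (set A)"
  shows "A_primitive A x \<longleftrightarrow>
    \<not> (\<exists>k\<ge>2. k dvd length x \<and> equal_parts (length A) (map (letter_code A) x) k)"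
  using abelian_power_imp_equal_parts[OF assms] equal_parts_imp_abelian_power[OF assms]
  unfolding A_primitive_def by (metis less_le_trans pos2)

section \<open>Trial division\<close>

text \<open>While the answer \<open>ok\<close> is 1, every prime divisor of \<open>n\<close> that
  passes the test \<open>G\<close> still divides the cofactor, so none has been lost; once it is 0,
  a witness exists. \<open>q \<le> n\<close> is stated separately because \<open>q dvd n\<close>
  bounds nothing when \<open>n = 0\<close>.\<close>

definition trial_inv :: "(nat \<Rightarrow> bool) \<Rightarrow> nat \<Rightarrow> nat \<Rightarrow> nat \<Rightarrow> nat \<Rightarrow> bool" where
  "trial_inv G n p q ok \<longleftrightarrow> 2 \<le> p \<and> q dvd n \<and> q \<le> n \<and> (\<forall>e\<ge>2. e < p \<longrightarrow> \<not> e dvd q) \<and>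
    (ok = 0 \<and> (\<exists>k\<ge>2. k dvd n \<and> G k) \<or>
     ok = 1 \<and> 0 < n \<and> (\<forall>e. prime e \<longrightarrow> e dvd n \<longrightarrow> G e \<longrightarrow> e dvd q))"

lemma trial_inv_init:
  assumes "n = 0 \<Longrightarrow> G 2"
  shows "trial_inv G n 2 n (if n = 0 then 0 else 1)"
  using assms by (auto simp: trial_inv_def)

lemma trial_inv_Suc:
  assumes "trial_inv G n p q ok" "\<not> p dvd q"
  shows "trial_inv G n (Suc p) q ok"
  using assms by (auto simp: trial_inv_def less_Suc_eq)

text \<open>As the least divisor \<ge> 2 of \<open>q\<close>, \<open>p\<close> is prime. If
  \<open>G p\<close> holds, \<open>p\<close> is the witness for the answer 0. Otherwise a prime
  passing the test differs from \<open>p\<close>, so dividing \<open>p * q'\<close> it divides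
  \<open>q'\<close>. The divisor \<open>p\<close> is kept, as it may divide \<open>q'\<close>
  again.\<close>

lemma trial_inv_div:
  assumes inv: "trial_inv G n p q ok" and dvd: "p dvd q"
  shows "trial_inv G n p (q div p) (ok * (if G p then 0 else 1))"
proof -
  from dvd obtain q' where q: "q = p * q'" by (auto elim: dvdE)
  have p: "2 \<le> p" and div: "q div p = q'" using inv q by (auto simp: trial_inv_def)
  \<comment> \<open>Primality of \<open>p\<close> is used in this form: a prime divisor of
    \<open>p\<close> is \<open>p\<close> itself.\<close>
  have least: "e = p" if "prime e" "e dvd p" for e
  proof -
    have "e dvd q" using that(2) q by simp
    then have "\<not> e < p" using inv prime_ge_2_nat[OF that(1)] by (auto simp: trial_inv_def)
    with dvd_imp_le[OF that(2)] p show ?thesis by simp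
  qed
  have dvdq': "e dvd q'" if "prime e" "\<not> G p" "G e" "e dvd q" for e
    using that least[of e] prime_dvd_mult_iff[of e p q'] q by auto
  have "q' dvd q" "q' \<le> q" using q p by auto
  then have "\<not> e dvd q'" if "2 \<le> e" "e < p" for e
    using inv that dvd_trans[of e q' q] unfolding trial_inv_def by blast
  moreover have "q' dvd n" "q' \<le> n"
    using inv \<open>q' dvd q\<close> \<open>q' \<le> q\<close> dvd_trans[of q' q n] unfolding trial_inv_def by auto
  moreover have "p dvd n" using inv dvd dvd_trans[of p q n] unfolding trial_inv_def by blast
  moreover have "ok = 0 \<and> (\<exists>k\<ge>2. k dvd n \<and> G k) \<or>
     ok = 1 \<and> 0 < n \<and> (\<forall>e. prime e \<longrightarrow> e dvd n \<longrightarrow> G e \<longrightarrow> e dvd q)"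
    using inv unfolding trial_inv_def by blast
  ultimately show ?thesis
    using p dvdq' unfolding trial_inv_def div by (cases "G p") auto
qed

text \<open>If some \<open>k\<close> passes, so does a prime factor \<open>e\<close> of it, and if
  the answer is not 0 then \<open>e\<close> divides \<open>q\<close>. Then
  \<open>e \<le> q < p\<close>, but \<open>q\<close> has no divisor from 2 up to
  \<open>p - 1\<close>.\<close>

lemma trial_inv_final:
  assumes inv: "trial_inv G n p q ok" and "q < p"
    and mono: "\<And>k e. G k \<Longrightarrow> k dvd n \<Longrightarrow> e dvd k \<Longrightarrow> 0 < k \<Longrightarrow> G e"
  shows "ok = 0 \<longleftrightarrow> (\<exists>k\<ge>2. k dvd n \<and> G k)"
proof (cases "ok = 0")
  case False
  have "\<not> (k dvd n \<and> G k)" if "2 \<le> k" for k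
  proof
    assume k: "k dvd n \<and> G k"
    obtain e where e: "prime e" "e dvd k" using \<open>2 \<le> k\<close> prime_factor_nat[of k] by auto
    then have "G e" "e dvd n" using mono[of k e] k that dvd_trans[of e k n] by auto
    with inv False e have "e dvd q" "q dvd n" "0 < n" by (auto simp: trial_inv_def)
    moreover from this have "e < p"
      using \<open>q < p\<close> dvd_imp_le[of e q] dvd_pos_nat[of n q] by simp
    ultimately show False
      using inv prime_ge_2_nat[OF e(1)] by (auto simp: trial_inv_def)
  qed
  with False show ?thesis by blast
qed (use inv in \<open>auto simp: trial_inv_def\<close>)

section \<open>The program\<close>

text \<open>Register 0 holds the length \<open>n\<close> of the input, 1 the constant 1, 2 the size \<open>m\<close> of
  the alphabet, 3 the limit of the current inner loop, 4 its counter \<open>u\<close>, 6 the distance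
  between two block boundaries in the table, 9 the trial divisor \<open>p\<close>, 10 the cofactor \<open>q\<close>,
  11 the answer (initially \<open>min 1 n\<close>, as the empty word is not A-primitive) and 12 the
  result of the test for \<open>p\<close>; the others are scratch. The number of occurrences of letter
  \<open>a\<close> among the first \<open>i\<close> letters is stored at address \<open>n + i * m + a\<close>.
  A nested loop over \<open>i\<close> and \<open>a\<close> is flattened into a loop over \<open>u = i * m + a\<close>.\<close>

definition table_step :: "instr list" where
  "table_step = [Div 6 4 2, Mod 7 4 2, Load 6 6,
     Sub 8 6 7, Sub 7 7 6, Add 7 7 8, Sub 7 1 7,
     Add 6 0 4, Load 8 6, Add 8 8 7, Add 6 6 2, Store 6 8, Add 4 4 1]"

text \<open>Row 0 of the table consists of zeros and is present in the initial memory. Round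
  \<open>u\<close> reads an entry of row \<open>u div m\<close> and writes the entry below
  it.\<close>

definition table_code :: "nat \<Rightarrow> code" where
  "table_code m =
    block [Const 1 1, Const 2 m, Mul 3 0 2, Const 4 0] ;;
    loop (block [Sub 5 3 4]) 5 (block table_step)"

text \<open>Truncated subtraction in both directions adds up to the distance between expected and
  actual count. Register 12 collects the distances; the final \<open>1 - (1 - v)\<close> clips it to
  0 or 1, so that its value stays bounded.\<close>

definition power_test_step :: "instr list" where
  "power_test_step = [Mod 7 4 2, Add 7 7 0, Div 8 4 2, Mul 8 8 6, Add 8 8 7,
     Add 7 7 6, Load 7 7, Load 13 8, Add 7 7 13, Add 8 8 6, Load 8 8,
     Sub 13 7 8, Sub 8 8 7, Add 8 8 13, Add 12 12 8, Sub 12 1 12, Sub 12 1 12, Add 4 4 1]"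

definition power_test_code :: code where
  "power_test_code =
    block [Div 6 0 9, Mul 6 6 2, Mul 3 9 2, Const 4 0, Const 12 0] ;;
    loop (block [Sub 5 3 4]) 5 (block power_test_step)"

text \<open>The guard \<open>q + 1 - p\<close> is nonzero iff \<open>p \<le> q\<close>. Running
  until \<open>q < p\<close> costs only linear time and leaves no final prime cofactor for separate
  treatment.\<close>

definition trial_code :: code where
  "trial_code =
    block [Const 9 2, Move 10 0, Sub 11 1 0, Sub 11 1 11] ;;
    loop (block [Add 5 10 1, Sub 5 5 9]) 5
      (block [Mod 5 10 9] ;;
       cond 5 (block [Add 9 9 1]) (power_test_code ;; block [Mul 11 11 12, Div 10 10 9]))"

definition decision_code :: "nat \<Rightarrow> code" where
  "decision_code m = table_code m ;; trial_code"

definition decision_program :: "nat \<Rightarrow> instr list" where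
  "decision_program m = (let c = decision_code m 0
    in c @ [JumpZero 11 (length c + 2), Halt True, Halt False])"

text \<open>The drop from \<open>q\<close> to \<open>q'\<close> releases \<open>42 * m + 16\<close>
  credits per unit. Since \<open>p \<le> 2 * (q - q')\<close>, the part \<open>42 * m\<close> pays
  \<open>21 * (p * m)\<close> for the power test. One 16 covers the overhead of 15: 5 steps up to
  the branch, 7 for setting up and leaving the test loop, 3 for the updates and the jump
  back.\<close>

lemma trial_budget:
  fixes p q q' m k c :: nat
  assumes "p + 2 * q' \<le> 2 * q" "q' + 1 \<le> q" "(42 * m + 16) * q + c + 3 \<le> k"
  shows "21 * (p * m) + 7 + ((42 * m + 16) * q' + c + 3 + 3) \<le> k - 1 - 1 - 1 - 1 - 1"
proof -
  have "21 * (p * m) + 42 * (m * q') \<le> 42 * (m * q)"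
    using mult_le_mono1[OF assms(1), of "21 * m"] by (simp add: algebra_simps)
  moreover have "42 * (m * q) + 16 * q + c + 3 \<le> k"
    using assms(3) by (simp add: algebra_simps)
  ultimately have "21 * (p * m) + 42 * (m * q') + 16 * q' + c + 18 \<le> k"
    using assms(2) by linarith
  then show ?thesis by (simp add: distrib_right)
qed

section \<open>Correctness and cost of the program components\<close>

locale coded_word =
  fixes m n B :: nat and y :: "nat list"
  assumes length_y: "length y = n"
    and y_less: "\<And>v. v \<in> set y \<Longrightarrow> v < m"
    and B: "2 * (n * m) + 3 * n + 2 * m + 4 \<le> B"
begin

definition table :: "(nat \<Rightarrow> nat) \<Rightarrow> bool" where
  "table M \<longleftrightarrow> (\<forall>i\<le>n. \<forall>a<m. M (n + i * m + a) = prefix_count y i a)"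

text \<open>A round costs 16: the 13 instructions of \<open>table_step\<close>, the guard, the test
  and the jump back. The 6 is four setup instructions plus the last guard and test;
  \<open>k0\<close> is left for the continuation.\<close>

lemma wp_table:
  assumes r: "r 0 = n"
    and input: "\<And>i. i < n \<Longrightarrow> M i = y ! i" and zero: "\<And>i. n \<le> i \<Longrightarrow> M i = 0"
    and k: "16 * (n * m) + 6 + k0 \<le> k"
    and Q: "\<And>r M k. r 0 = n \<Longrightarrow> r 1 = 1 \<Longrightarrow> r 2 = m \<Longrightarrow> table M \<Longrightarrow> k0 \<le> k \<Longrightarrow> Q r M k"
  shows "wp B (table_code m) Q r M k"
proof -
  \<comment> \<open>The bound \<open>m + r 4\<close> includes row 0, which is valid before the first
    round.\<close>
  define I where "I r M k \<longleftrightarrow> r 0 = n \<and> r 1 = 1 \<and> r 2 = m \<and> r 3 = n * m \<and>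
    r 4 \<le> n * m \<and> (\<forall>i<n. M i = y ! i) \<and>
    (\<forall>u<m + r 4. M (n + u) = prefix_count y (u div m) (u mod m)) \<and>
    16 * (n * m - r 4) + 2 + k0 \<le> k" for r M :: "nat \<Rightarrow> nat" and k :: nat
  have step: "wp_block B table_step (\<lambda>r M k. 0 < k \<and> I r M (k - 1)) r M (k - 2)"
    if I: "I r M k" and "r 4 < n * m" for r M k
  proof -
    define w where "w = r 4"
    have w: "w < n * m" using that by (simp add: w_def)
    then have m: "0 < m" by (cases m) auto
    define i a where "i = w div m" and "a = w mod m"
    have i: "i < n" and a: "a < m" using w m by (auto simp: i_def a_def less_mult_imp_div_less)
    have yi: "y ! i < m" using y_less i length_y by simp
    have Mi: "M i = y ! i" and Mw: "M (n + w) = prefix_count y i a"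
      using I i w m by (auto simp: I_def w_def i_def a_def)
    have le: "prefix_count y i a \<le> n" using prefix_count_le[of y] length_y by simp
    have new: "prefix_count y (Suc (w div m)) (w mod m) =
        prefix_count y i a + (if y ! i = a then 1 else 0)"
      using i length_y by (simp add: prefix_count_Suc i_def a_def)
    \<comment> \<open>The two truncated differences sum to the distance of the codes, and 1 minus it
      indicates equality.\<close>
    have eq: "Suc 0 - (a - y ! i + (y ! i - a)) = (if y ! i = a then 1 else 0)" by auto
    have r: "r 0 = n" "r 1 = 1" "r 2 = m" "r 3 = n * m" "r 4 = w"
      and k: "16 * (n * m - w) + 2 + k0 \<le> k" using I by (simp_all add: I_def w_def)
    then have k18: "18 \<le> k" using w by simp
    have "I r' (M(n + w + m := prefix_count y i a + (if y ! i = a then 1 else 0))) (k - 16)"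
      if "r' 0 = n" "r' 1 = 1" "r' 2 = m" "r' 3 = n * m" "r' 4 = Suc w" for r'
    proof -
      \<comment> \<open>The same letter in the next row lies \<open>m\<close> cells further
        on.\<close>
      have "(w + m) div m = Suc (w div m)" "(w + m) mod m = w mod m" using m by simp_all
      then show ?thesis
        using I w k that by (auto simp: I_def less_Suc_eq new w_def [symmetric] add.commute[of w m])
    qed
    moreover have "a - y ! i + (y ! i - a) \<le> B" using yi a B by linarith
    ultimately show ?thesis
      unfolding table_step_def using r k18 w B yi a le
      by (simp add: Mi Mw eq flip: i_def a_def)
  qed
  have loop: "wp B (loop (block [Sub 5 3 4]) 5 (block table_step)) Q r M k"
    if "I r M k" for r M k
    using that
  proof (rule wp_loop[where I = I], intro wp_block)
    fix r M k assume I: "I r M k"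
    show "wp_block B [Sub 5 3 4] (\<lambda>r M k. 0 < k \<and>
        (if r 5 = 0 then Q r M (k - 1)
         else wp B (block table_step) (\<lambda>r M k. 0 < k \<and> I r M (k - 1)) r M (k - 1))) r M k"
    proof (cases "r 4 < n * m")
      case True
      let ?r = "r(5 := n * m - r 4)"
      have "I ?r M k" using I by (simp add: I_def)
      with True have "wp_block B table_step (\<lambda>r M k. 0 < k \<and> I r M (k - 1)) ?r M (k - 2)"
        using step by simp
      then show ?thesis using True I by (simp add: I_def wp_block numeral_2_eq_2)
    next
      case False
      then have full: "r 4 = n * m" using I by (simp add: I_def)
      have "table M"
        unfolding table_def
      proof (intro allI impI)
        fix i a assume "i \<le> n" "a < m"
        then have "i * m + a < n * m + m"
          by (meson add_le_less_mono mult_le_mono1)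
        with I \<open>a < m\<close> show "M (n + i * m + a) = prefix_count y i a"
          by (simp add: I_def full add.assoc)
      qed
      with Q[of "r(5 := 0)" M "k - 2"] I show ?thesis
        by (auto simp: I_def full numeral_2_eq_2)
    qed
  qed
  have "I (r(1 := 1, 2 := m, 3 := n * m, 4 := 0)) M (k - 1 - 1 - 1 - 1)"
    using r input zero k by (auto simp: I_def)
  from loop[OF this] show ?thesis
    unfolding table_code_def using r B k by (intro wp_seq wp_block) simp
qed

text \<open>A round costs 21: 18 instructions, guard, test and jump back. The 7 is five setup
  instructions plus the last guard and test.\<close>

lemma wp_power_test:
  assumes r: "r 0 = n" "r 1 = 1" "r 2 = m" "r 9 = p" and p: "p dvd n" "0 < p" "p \<le> n"
    and M: "table M"
    and k: "21 * (p * m) + 7 + k0 \<le> k"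
    and Q: "\<And>r' k. r' 0 = n \<Longrightarrow> r' 1 = 1 \<Longrightarrow> r' 2 = m \<Longrightarrow> r' 9 = p \<Longrightarrow> r' 10 = r 10 \<Longrightarrow>
      r' 11 = r 11 \<Longrightarrow> r' 12 = (if equal_parts m y p then 0 else 1) \<Longrightarrow> k0 \<le> k \<Longrightarrow> Q r' M k"
  shows "wp B power_test_code Q r M k"
proof -
  define q ok where "q = r 10" and "ok = r 11"
  define d where "d = n div p"
  have pd: "p * d = n" using p(1) by (simp add: d_def)
  define D where "D = d * m"
  have pD: "p * D = n * m" by (simp add: D_def flip: pd)
  define T where "T u \<longleftrightarrow> prefix_count y (Suc (u div m) * d) (u mod m) =
    prefix_count y (u div m * d) (u mod m) + prefix_count y d (u mod m)" for u
  have T: "equal_parts m y p \<longleftrightarrow> (\<forall>u<p * m. T u)"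
    unfolding T_def by (rule equal_parts_iff_step) (simp add: d_def length_y)
  define I where "I r' M' k \<longleftrightarrow> r' 0 = n \<and> r' 1 = 1 \<and> r' 2 = m \<and> r' 3 = p * m \<and>
    r' 4 \<le> p * m \<and> r' 6 = D \<and> r' 9 = p \<and> r' 10 = q \<and> r' 11 = ok \<and>
    r' 12 = (if \<forall>u<r' 4. T u then 0 else 1) \<and> M' = M \<and>
    21 * (p * m - r' 4) + 2 + k0 \<le> k" for r' M' :: "nat \<Rightarrow> nat" and k :: nat
  have step: "wp_block B power_test_step (\<lambda>r M k. 0 < k \<and> I r M (k - 1)) r' M' (k - 2)"
    if I: "I r' M' k" and "r' 4 < p * m" for r' M' k
  proof -
    define u where "u = r' 4"
    have u: "u < p * m" using that by (simp add: u_def)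
    then have m: "0 < m" by (cases m) auto
    define j a where "j = u div m" and "a = u mod m"
    have j: "Suc j \<le> p" and a: "a < m" using u m by (auto simp: j_def a_def less_mult_imp_div_less Suc_leI)
    have "Suc j * d \<le> n" using mult_le_mono1[OF j, of d] by (simp add: pd)
    moreover have "d \<le> n" using p by (simp add: d_def)
    moreover have "j * d \<le> n" using calculation by simp
    moreover have "M (n + i * m + a) = prefix_count y i a" if "i \<le> n" for i
      using M a that by (simp add: table_def)
    ultimately have "M (n + d * m + a) = prefix_count y d a"
      "M (n + j * d * m + a) = prefix_count y (j * d) a"
      "M (n + Suc j * d * m + a) = prefix_count y (Suc j * d) a" by blast+
    \<comment> \<open>The same addresses, in the form in which the program computes them.\<close>
    then have
      M1: "M (a + n + D) = prefix_count y d a" and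
      M2: "M (j * D + (a + n)) = prefix_count y (j * d) a" and
      M3: "M (j * D + (a + n) + D) = prefix_count y (Suc j * d) a"
      by (simp_all add: D_def algebra_simps)
    have jD: "j * D + D \<le> n * m" using mult_le_mono1[OF j, of D] by (simp add: pD)
    have um: "u + 1 \<le> n * m" using u mult_le_mono1[OF p(3), of m] by linarith
    have le: "prefix_count y i a \<le> n" for i using prefix_count_le[of y] length_y by simp
    have r: "r' 0 = n" "r' 1 = 1" "r' 2 = m" "r' 3 = p * m" "r' 4 = u" "r' 6 = D" "r' 9 = p"
      "r' 10 = q" "r' 11 = ok" "r' 12 = (if \<forall>v<u. T v then 0 else 1)" and M': "M' = M"
      and k: "21 * (p * m - u) + 2 + k0 \<le> k" using I by (simp_all add: I_def u_def)
    then have k23: "23 \<le> k" using u by simp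
    define s where "s = prefix_count y d a + prefix_count y (j * d) a"
    define e where "e = prefix_count y (d + j * d) a - s + (s - prefix_count y (d + j * d) a)"
    have e: "e = 0 \<longleftrightarrow> T u" by (auto simp: T_def e_def s_def j_def a_def)
    have clip: "Suc 0 - (Suc 0 - e) = (if e = 0 then 0 else 1)" by simp
    have "s \<le> 2 * n" using le[of d] le[of "j * d"] by (simp add: s_def)
    moreover from this have "e \<le> 2 * n" using le[of "d + j * d"] by (simp add: e_def)
    moreover have "I r'' M (k - 21)"
      if "r'' 0 = n" "r'' 1 = 1" "r'' 2 = m" "r'' 3 = p * m" "r'' 4 = Suc u" "r'' 6 = D" "r'' 9 = p"
        "r'' 10 = q" "r'' 11 = ok" "r'' 12 = (if (\<forall>v<u. T v) \<and> e = 0 then 0 else 1)" for r''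
      using that k u by (auto simp: I_def e less_Suc_eq)
    ultimately show ?thesis
      unfolding power_test_step_def using r k23 B a jD um le[of d] le[of "j * d"]
      by (simp add: M1 M2 M3 M' clip flip: j_def a_def s_def e_def)
  qed
  have loop: "wp B (loop (block [Sub 5 3 4]) 5 (block power_test_step)) Q r' M' k"
    if "I r' M' k" for r' M' k
    using that
  proof (rule wp_loop[where I = I], intro wp_block)
    fix r' M' k assume I: "I r' M' k"
    show "wp_block B [Sub 5 3 4] (\<lambda>r M k. 0 < k \<and>
        (if r 5 = 0 then Q r M (k - 1)
         else wp B (block power_test_step) (\<lambda>r M k. 0 < k \<and> I r M (k - 1)) r M (k - 1))) r' M' k"
    proof (cases "r' 4 < p * m")
      case True
      let ?r = "r'(5 := p * m - r' 4)"
      have "I ?r M' k" using I by (simp add: I_def)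
      with True have "wp_block B power_test_step (\<lambda>r M k. 0 < k \<and> I r M (k - 1)) ?r M' (k - 2)"
        using step by simp
      then show ?thesis using True I by (simp add: I_def wp_block numeral_2_eq_2)
    next
      case False
      then have full: "r' 4 = p * m" using I by (simp add: I_def)
      with I have "Q (r'(5 := 0)) M (k - 2)"
        by (intro Q) (auto simp: I_def T q_def ok_def)
      with I show ?thesis by (auto simp: I_def full numeral_2_eq_2)
    qed
  qed
  have "I (r(6 := D, 3 := p * m, 4 := 0, 12 := 0)) M (k - 1 - 1 - 1 - 1 - 1)"
    using r M k by (auto simp: I_def q_def ok_def)
  note loop = loop[OF this]
  have "n div p * m \<le> B" "p * m \<le> B"
    using mult_le_mono1[OF p(3), of m] mult_le_mono1[OF div_le_dividend, of n p m] B by linarith+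
  then show ?thesis
    unfolding power_test_code_def using r B k loop
    by (intro wp_seq wp_block) (simp add: D_def d_def)
qed

lemma wp_trial:
  assumes r: "r 0 = n" "r 1 = 1" "r 2 = m" and M: "table M"
    and k: "(42 * m + 16) * n + 8 * n + 7 \<le> k"
    and Q: "\<And>r k. (r 11 = 0 \<longleftrightarrow> (\<exists>k\<ge>2. k dvd n \<and> equal_parts m y k)) \<Longrightarrow> Q r M k"
  shows "wp B trial_code Q r M k"
proof -
  \<comment> \<open>A potential: the first summand pays for power tests as \<open>q\<close> drops.
    Each increment of \<open>p\<close> costs 8: two guard instructions, loop test,
    \<open>Mod\<close>, branch test, \<open>Add\<close> and two jumps. The 3 pays for the last guard
    and test.\<close>
  define credit where "credit p q = (42 * m + 16) * q + 8 * (n + 2 - p) + 3" for p q :: nat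
  define I where "I r M' k \<longleftrightarrow> r 0 = n \<and> r 1 = 1 \<and> r 2 = m \<and> M' = M \<and>
    trial_inv (equal_parts m y) n (r 9) (r 10) (r 11) \<and>
    credit (r 9) (r 10) \<le> k"
    for r M' :: "nat \<Rightarrow> nat" and k :: nat
  let ?guard = "[Add 5 10 1, Sub 5 5 9]"
  let ?body = "block [Mod 5 10 9] ;;
    cond 5 (block [Add 9 9 1]) (power_test_code ;; block [Mul 11 11 12, Div 10 10 9])"
  let ?post = "\<lambda>r M k. 0 < k \<and> I r M (k - 1)"
  have step: "wp B ?body ?post r M (k - 1 - 1 - 1)"
    if I: "I r' M k" and pq: "r' 9 \<le> r' 10" and r: "r = r'(5 := Suc (r' 10) - r' 9)" for r r' k
  proof -
    define p q ok where "p = r 9" and "q = r 10" and "ok = r 11"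
    have inv: "trial_inv (equal_parts m y) n p q ok" and r: "r 0 = n" "r 1 = 1" "r 2 = m"
      and k: "credit p q \<le> k" and pq: "p \<le> q"
      using I pq by (simp_all add: I_def p_def q_def ok_def r)
    have p: "2 \<le> p" and q: "q \<le> n" "q dvd n" and ok: "ok \<le> 1"
      using inv by (auto simp: trial_inv_def)
    have "8 * 2 \<le> 8 * (n + 2 - p)" using pq q by linarith
    moreover have "16 * 1 \<le> (42 * m + 16) * q" using p pq by (intro mult_le_mono) auto
    ultimately have k10: "10 \<le> k" using k unfolding credit_def by linarith
    let ?r = "r(5 := q mod p)"
    have "wp B (cond 5 (block [Add 9 9 1]) (power_test_code ;; block [Mul 11 11 12, Div 10 10 9]))
        ?post ?r M (k - 1 - 1 - 1 - 1)"
    proof (rule wp_cond)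
      show "0 < k - 1 - 1 - 1 - 1" using k10 by simp
    next
      assume "?r 5 \<noteq> 0"
      then have "trial_inv (equal_parts m y) n (Suc p) q ok"
        using trial_inv_Suc[OF inv] by (simp add: mod_eq_0_iff_dvd)
      moreover have "n + 2 - p = Suc (n + 2 - Suc p)" using pq q by simp
      then have "credit (Suc p) q + 8 = credit p q" by (simp only: credit_def mult_Suc_right add_ac)
      with k have "credit (Suc p) q \<le> k - 1 - 1 - 1 - 1 - 1 - 1 - 1 - 1" by simp
      ultimately have "I (?r(9 := Suc p)) M (k - 1 - 1 - 1 - 1 - 1 - 1 - 1 - 1)"
        using r by (simp add: I_def q_def ok_def)
      then show "wp B (block [Add 9 9 1]) (\<lambda>r M k. 0 < k \<and> ?post r M (k - 1)) ?r M
          (k - 1 - 1 - 1 - 1 - 1)"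
        using r pq q B k10 by (intro wp_block) (simp add: p_def)
    next
      assume "?r 5 = 0"
      then have dvd: "p dvd q" by (simp add: mod_eq_0_iff_dvd)
      then obtain q' where q': "q = p * q'" by (auto elim: dvdE)
      have "0 < q'" using q' p pq by (cases q') auto
      \<comment> \<open>As \<open>q - q' = (p - 1) * q'\<close> and
        \<open>p \<le> 2 * (p - 1)\<close>, the cofactor drops by at least half of
        \<open>p\<close>.\<close>
      then have "p \<le> 2 * (p - 1) * q'" using p by (cases q') auto
      then have drop: "q' + 1 \<le> q" "p + 2 * q' \<le> 2 * q"
        using p \<open>0 < q'\<close> by (auto simp: q' algebra_simps diff_mult_distrib)
      have k': "21 * (p * m) + 7 + (credit p q' + 3) \<le> k - 1 - 1 - 1 - 1 - 1"
        unfolding credit_def by (rule trial_budget[OF drop(2,1) k[unfolded credit_def]])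
      show "wp B (power_test_code ;; block [Mul 11 11 12, Div 10 10 9]) ?post ?r M (k - 1 - 1 - 1 - 1 - 1)"
      proof (rule wp_seq, rule wp_power_test[OF _ _ _ _ _ _ _ M k'])
        fix r' :: "nat \<Rightarrow> nat" and k
        assume r': "r' 0 = n" "r' 1 = 1" "r' 2 = m" "r' 9 = p" "r' 10 = ?r 10"
          "r' 11 = ?r 11" "r' 12 = (if equal_parts m y p then 0 else 1)"
          and k: "credit p q' + 3 \<le> k"
        have "trial_inv (equal_parts m y) n p q' (ok * r' 12)"
          using trial_inv_div[OF inv dvd] r'(7) p by (simp add: q')
        then have "I (r'(11 := ok * r' 12, 10 := q')) M (k - 1 - 1 - 1)"
          using r' k by (simp add: I_def)
        moreover have "q div p = q'" using p by (simp add: q')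
        moreover have "ok * r' 12 \<le> B" using ok r'(7) B by auto
        ultimately show "wp B (block [Mul 11 11 12, Div 10 10 9]) ?post r' M k"
          using r' k by (intro wp_block, cases "equal_parts m y p") (simp_all add: q_def ok_def)
      qed (use r p pq q dvd_trans[OF dvd q(2)] in \<open>simp_all add: p_def\<close>)
    qed
    then show ?thesis
      using k10 by (intro wp_seq wp_block) (simp add: p_def q_def)
  qed
  have loop: "wp B (loop (block ?guard) 5 ?body) Q r M k" if "I r M k" for r k
    using that
  proof (rule wp_loop[where I = I], intro wp_block)
    fix r M' k assume I: "I r M' k"
    then have M': "M' = M" and c: "credit (r 9) (r 10) \<le> k"
      and inv: "trial_inv (equal_parts m y) n (r 9) (r 10) (r 11)"
      by (simp_all add: I_def)
    have k: "3 \<le> k" using c by (simp add: credit_def)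
    have "r 10 + 1 \<le> B" using B inv by (simp add: trial_inv_def)
    show "wp_block B ?guard (\<lambda>r M k. 0 < k \<and>
        (if r 5 = 0 then Q r M (k - 1) else wp B ?body ?post r M (k - 1))) r M' k"
    proof (cases "r 9 \<le> r 10")
      case True
      then show ?thesis
        using step[OF I[unfolded M'] True refl] k \<open>r 10 + 1 \<le> B\<close> I by (simp add: I_def M')
    next
      case False
      have "r 11 = 0 \<longleftrightarrow> (\<exists>k\<ge>2. k dvd n \<and> equal_parts m y k)"
        using False by (intro trial_inv_final[OF inv]) (auto intro: equal_parts_mono simp: length_y)
      then have "Q (r(5 := 0)) M (k - 1 - 1 - 1)"
        by (intro Q) simp
      then show ?thesis
        using False k \<open>r 10 + 1 \<le> B\<close> I by (simp add: I_def M')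
    qed
  qed
  \<comment> \<open>On the empty word all prefix counts vanish, so exponent 2 is a witness;
    accordingly \<open>1 - (1 - n)\<close> starts the answer at 0 exactly when
    \<open>n = 0\<close>.\<close>
  have "n = 0 \<Longrightarrow> equal_parts m y 2"
    using length_y by (simp add: equal_parts_def)
  then have "trial_inv (equal_parts m y) n 2 n (1 - (1 - n))"
    using trial_inv_init[of n "equal_parts m y"] by (cases "n = 0") simp_all
  moreover have "credit 2 n \<le> k - 1 - 1 - 1 - 1"
    using k unfolding credit_def by linarith
  ultimately have "I (r(9 := 2, 10 := n, 11 := 1 - (1 - n))) M (k - 1 - 1 - 1 - 1)"
    using r by (simp add: I_def)
  moreover have k4: "4 \<le> k" using k by linarith
  ultimately show ?thesis
    unfolding trial_code_def using r B loop by (intro wp_seq wp_block) simp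
qed

text \<open>The budgets of both phases add up: \<open>58 = 16 + 42\<close>,
  \<open>24 = 16 + 8\<close> and \<open>13 = 6 + 7\<close>.\<close>

lemma wp_decision:
  assumes r: "r 0 = n"
    and input: "\<And>i. i < n \<Longrightarrow> M i = y ! i" and zero: "\<And>i. n \<le> i \<Longrightarrow> M i = 0"
    and k: "58 * (n * m) + 24 * n + 13 \<le> k"
  shows "wp B (decision_code m)
    (\<lambda>r M k. r 11 = 0 \<longleftrightarrow> (\<exists>k\<ge>2. k dvd n \<and> equal_parts m y k)) r M k"
  unfolding decision_code_def
proof (rule wp_seq, rule wp_table)
  show "16 * (n * m) + 6 + ((42 * m + 16) * n + 8 * n + 7) \<le> k"
  proof -
    have "(42 * m + 16) * n = 42 * (n * m) + 16 * n" by (simp add: algebra_simps)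
    then show ?thesis using k by linarith
  qed
  show "r 0 = n" by (rule r)
  show "M i = y ! i" if "i < n" for i using that by (rule input)
  show "M i = 0" if "n \<le> i" for i using that by (rule zero)
  show "wp B trial_code (\<lambda>r M k. r 11 = 0 \<longleftrightarrow> (\<exists>k\<ge>2. k dvd n \<and> equal_parts m y k)) r M k"
    if "r 0 = n" "r 1 = 1" "r 2 = m" "table M" "(42 * m + 16) * n + 8 * n + 7 \<le> k" for r M k
    using that by (rule wp_trial) assumption
qed

end

text \<open>Placing the code at address 0 turns credits into a bound on actual steps. The one
  additional step is the jump on register 11 that selects the \<open>Halt\<close>
  instruction.\<close>

lemma decision_program_halts:
  assumes "distinct A" "x \<in> lists (set A)"
  defines "m \<equiv> length A" and "n \<equiv> length x"
  assumes B: "2 * (n * m) + 3 * n + 2 * m + 4 \<le> B"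
  shows "\<exists>t \<le> 58 * (n * m) + 24 * n + 14.
    halted_with (decision_program m) (x \<in> AQ A) (run (decision_program m) t (init A x)) \<and>
    (\<forall>s\<le>t. values_bounded B (run (decision_program m) s (init A x)))"
proof -
  define y where "y = map (letter_code A) x"
  have codes: "v < m" if "v \<in> set y" for v
    using that assms(2) by (auto simp: y_def m_def letter_code_less)
  interpret coded_word m n B y
    using B codes by unfold_locales (simp_all add: y_def n_def)
  define r M :: "nat \<Rightarrow> nat" where "r = (\<lambda>_. 0)(0 := n)" and "M = (\<lambda>i. if i < n then y ! i else 0)"
  have init: "init A x = cfg 0 r M"
    by (auto simp: init_def r_def M_def y_def n_def)
  have "y ! i \<le> B" if "i < n" for i
    using codes[of "y ! i"] that length_y B by simp
  then have bnd: "values_bounded B (cfg 0 r M)"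
    using B by (auto simp: values_bounded_def r_def M_def)
  define c where "c = decision_code m 0"
  let ?P = "decision_program m"
  have P: "?P = c @ [JumpZero 11 (length c + 2), Halt True, Halt False]"
    by (simp add: decision_program_def c_def Let_def)
  then have code: "?P = [] @ decision_code m 0 @ [JumpZero 11 (length c + 2), Halt True, Halt False]"
    by (simp add: c_def)
  have wp: "wp B (decision_code m)
      (\<lambda>r M k. r 11 = 0 \<longleftrightarrow> (\<exists>k\<ge>2. k dvd n \<and> equal_parts m y k)) r M
      (58 * (n * m) + 24 * n + 13)"
    by (rule wp_decision) (simp_all add: r_def M_def)
  obtain t r' M' where t: "t \<le> 58 * (n * m) + 24 * n + 13"
    "reach ?P B t (cfg 0 r M) (cfg (length c) r' M')"
    "r' 11 = 0 \<longleftrightarrow> (\<exists>k\<ge>2. k dvd n \<and> equal_parts m y k)"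
    by (rule wpE[OF wp code]) (use bnd in \<open>simp_all add: c_def that\<close>)
  define l where "l = length c + (if r' 11 = 0 then 2 else 1)"
  have "reach ?P B 1 (cfg (length c) r' M') (cfg l r' M')"
    using reach_bounded[OF t(2)] unfolding P l_def
    by (intro reach_step) (auto simp: step_def nth_append values_bounded_def)
  from reach_trans[OF t(2) this] have reach: "reach ?P B (t + 1) (cfg 0 r M) (cfg l r' M')" .
  have "x \<in> AQ A \<longleftrightarrow> r' 11 \<noteq> 0"
    using A_primitive_iff[OF assms(1,2)] assms(2) t(3) by (simp add: AQ_def y_def m_def n_def)
  then have "halted_with ?P (x \<in> AQ A) (cfg l r' M')"
    by (auto simp: halted_with_def P l_def nth_append)
  with reach t(1) show ?thesis
    unfolding init reach_def by (intro exI[of _ "t + 1"]) auto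
qed

theorem theorem3:
  fixes A :: "'a list"
  assumes "distinct A"
  shows "\<exists>P T B. (\<lambda>n. real (T n)) \<in> O(\<lambda>n. real n) \<and>
    (\<lambda>n. real (B n)) \<in> O(\<lambda>n. real n) \<and>
    decides_within P A (AQ A) T B"
proof -
  define m where "m = length A"
  \<comment> \<open>For \<open>n \<ge> 1\<close> the constant is absorbed by
    \<open>b \<le> b * n\<close>.\<close>
  have linear: "(\<lambda>n. real (a * n + b)) \<in> O(\<lambda>n. real n)" for a b :: nat
  proof (rule bigoI[where c = "real (a + b)"])
    show "\<forall>\<^sub>F n in sequentially. norm (real (a * n + b)) \<le> real (a + b) * norm (real n)"
      using eventually_ge_at_top[of 1]
    proof eventually_elim
      case (elim n)
      have "a * n + b \<le> (a + b) * n" using elim by (simp add: algebra_simps)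
      then show ?case unfolding of_nat_mult[symmetric] norm_of_nat of_nat_le_iff .
    qed
  qed
  \<comment> \<open>Both are linear in \<open>n\<close> because \<open>m\<close> is fixed.
    \<open>?B\<close> dominates the table addresses, below \<open>n + n * m + m\<close>, and the
    sums of a few counts, each at most \<open>n\<close>.\<close>
  let ?T = "\<lambda>n. (58 * m + 24) * n + 14" and ?B = "\<lambda>n. (2 * m + 3) * n + (2 * m + 4)"
  have decides: "decides_within (decision_program m) A (AQ A) ?T ?B"
    unfolding decides_within_def
  proof
    fix x assume "x \<in> lists (set A)"
    from decision_program_halts[OF assms this, of "?B (length x)"]
    show "\<exists>t\<le>?T (length x).
        halted_with (decision_program m) (x \<in> AQ A) (run (decision_program m) t (init A x)) \<and>
        (\<forall>s\<le>t. values_bounded (?B (length x)) (run (decision_program m) s (init A x)))"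
      by (simp add: m_def algebra_simps)
  qed
  show ?thesis
    by (rule exI[of _ "decision_program m"], rule exI[of _ ?T], rule exI[of _ ?B])
      (intro conjI linear decides)
qed

end
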